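(* Let $d$ be a positive integer. Every loop-less maximum independent set (LMIS) of $B(d,3)$ is a maximum comma-free code of length $3$ over the alphabet $\{0,\dots,d-1\}$. In particular, the number of equivalence classes of comma-free codes of length $3$ in an alphabet of size $d$ is at least $2^d$, where equivalence means equivalence under the action of the symmetric group $\mathbb{S}_d$ permuting the alphabet.
   Context: Let $[d]=\{0,\dots,d-1\}$. The de Bruijn graph $B(d,3)$ is the directed graph whose nodes are the words $xyz$ with $x,y,z\in[d]$, with an edge from $x_1x_2x_3$ to $y_1y_2y_3$ if and only if $x_2x_3=y_1y_2$; in particular each node $xxx$ has an edge to itself. An LMIS of $B(d,3)$ is an independent set of $B(d,3)$ of maximum cardinality, where independent means that no edge joins two (not necessarily distinct) elements of the set; in particular it contains no node $xxx$. A comma-free code of length $3$ over $[d]$ is a set $S$ of words of length $3$ over $[d]$ such that whenever $x_1x_2x_3$ and $y_1y_2y_3$ are (not necessarily distinct) elements of $S$, neither $x_2x_3y_1$ nor $x_3y_1y_2$ is in $S$. A maximum comma-free code is one of maximum cardinality among comma-free codes of length $3$ over $[d]$. The group $\mathbb{S}_d$ of permutations of $[d]$ acts on words by $\sigma(xyz)=\sigma(x)\sigma(y)\sigma(z)$ and hence on codes.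
   Formalization: The bound 2^d on the number of equivalence classes is stated for d at least 2 only; for d = 1 it fails, since the empty code is the only comma-free code over one letter, giving 1 class instead of 2. *)

theory Defs
  imports "HOL-Combinatorics.Permutations" "Graph_Theory.Pair_Digraph"
begin

text \<open>Words of length 3 are triples of letters; the alphabet of size \<open>d\<close> is \<open>{..<d}\<close>.\<close>

type_synonym word3 = "nat \<times> nat \<times> nat"

definition words3 :: "nat \<Rightarrow> word3 set" where
  "words3 d = {..<d} \<times> {..<d} \<times> {..<d}"

definition deBruijn3 :: "nat \<Rightarrow> word3 pair_pre_digraph" where
  "deBruijn3 d =
    \<lparr> pverts = words3 d,
      parcs = {((x1, x2, x3), (y1, y2, y3)) | x1 x2 x3 y1 y2 y3.
        (x1, x2, x3) \<in> words3 d \<and> (y1, y2, y3) \<in> words3 d \<and> (x2, x3) = (y1, y2)} \<rparr>"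

text \<open>The two vertices need not be distinct, so an independent set contains no vertex carrying
  a loop. This is the sense of ``loop-less'' in the next definition.\<close>

definition independent_set :: "'a pair_pre_digraph \<Rightarrow> 'a set \<Rightarrow> bool" where
  "independent_set G S \<longleftrightarrow> S \<subseteq> pverts G \<and> (\<forall>u\<in>S. \<forall>v\<in>S. (u, v) \<notin> parcs G)"

definition LMIS :: "nat \<Rightarrow> word3 set \<Rightarrow> bool" where
  "LMIS d S \<longleftrightarrow> independent_set (deBruijn3 d) S \<and>
    (\<forall>T. independent_set (deBruijn3 d) T \<longrightarrow> card T \<le> card S)"

definition comma_free :: "nat \<Rightarrow> word3 set \<Rightarrow> bool" where
  "comma_free d S \<longleftrightarrow> S \<subseteq> words3 d \<and>
    (\<forall>(x1, x2, x3)\<in>S. \<forall>(y1, y2, y3)\<in>S. (x2, x3, y1) \<notin> S \<and> (x3, y1, y2) \<notin> S)"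

definition max_comma_free :: "nat \<Rightarrow> word3 set \<Rightarrow> bool" where
  "max_comma_free d S \<longleftrightarrow> comma_free d S \<and> (\<forall>T. comma_free d T \<longrightarrow> card T \<le> card S)"

definition act_word :: "(nat \<Rightarrow> nat) \<Rightarrow> word3 \<Rightarrow> word3" where
  "act_word \<sigma> = (\<lambda>(x, y, z). (\<sigma> x, \<sigma> y, \<sigma> z))"

text \<open>The relation of lying in the same orbit under the symmetric group on \<open>{..<d}\<close>, restricted
  to a family \<open>C\<close> of codes; \<open>C // code_equiv d C\<close> is the set of equivalence classes.\<close>

definition code_equiv :: "nat \<Rightarrow> word3 set set \<Rightarrow> (word3 set \<times> word3 set) set" where
  "code_equiv d C =
    {(S, T). S \<in> C \<and> T \<in> C \<and> (\<exists>\<sigma>. \<sigma> permutes {..<d} \<and> T = act_word \<sigma> ` S)}"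

definition num_classes :: "nat \<Rightarrow> word3 set set \<Rightarrow> nat" where
  "num_classes d C = card (C // code_equiv d C)"

text \<open>Over a one-letter alphabet the empty code is the only comma-free code, so there is exactly
  one class, fewer than \<open>2 ^ 1\<close>: the lower bound \<open>2 ^ d\<close> can hold only from \<open>d = 2\<close> on.\<close>

lemma comma_free_1: "comma_free 1 S \<longleftrightarrow> S = {}"
proof
  assume cf: "comma_free 1 S"
  show "S = {}"
  proof (rule ccontr)
    assume "S \<noteq> {}"
    then have "(0, 0, 0) \<in> S"
      using cf by (auto simp: comma_free_def words3_def)
    then show False
      using cf by (auto simp: comma_free_def)
  qed
qed (simp add: comma_free_def)

lemma num_classes_1:
  "num_classes 1 {S. comma_free 1 S} = 1"
  "num_classes 1 {S. max_comma_free 1 S} = 1"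
proof -
  have *: "num_classes 1 {{}} = 1"
    by (auto simp: num_classes_def quotient_def)
  show "num_classes 1 {S. comma_free 1 S} = 1"
    using * by (simp add: comma_free_1 del: One_nat_def)
  have "{S. max_comma_free 1 S} = {{}}"
    by (auto simp: max_comma_free_def comma_free_1 simp del: One_nat_def)
  then show "num_classes 1 {S. max_comma_free 1 S} = 1"
    using * by simp
qed

end

theory Submission imports Defs begin

text \<open>
  A comma-free code contains at most one word of each rotation class \<open>{xyz, yzx, zxy}\<close>, and no
  constant word. Hence a code that meets every class of non-constant words is at least as large
  as every comma-free code (lemma \<open>card_comma_free_le_transversal\<close>).

  Think of \<open>xyz\<close> as the arc from \<open>xy\<close> to \<open>yz\<close> in the de Bruijn graph on pairs. A relation \<open>A\<close> on
  letters splits the pairs into two sides, and the arcs that leave \<open>A\<close> form an independent set of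
  words, since no two of them are consecutive. Independence implies comma-freeness: \<open>x\<^sub>2x\<^sub>3y\<^sub>1\<close> is a
  successor of \<open>x\<^sub>1x\<^sub>2x\<^sub>3\<close>, and \<open>x\<^sub>3y\<^sub>1y\<^sub>2\<close> is a predecessor of \<open>y\<^sub>1y\<^sub>2y\<^sub>3\<close>. The rotations of \<open>xyz\<close>
  form a closed walk through \<open>xy\<close>, \<open>yz\<close>, \<open>zx\<close>, which contains an arc of the cut as soon as it
  visits both sides. So if every such walk with \<open>x\<close>, \<open>y\<close>, \<open>z\<close> not all equal visits both sides, then
  the cut meets all the classes and is optimal in both senses. The relation \<open><\<close> has this property.
  Therefore the two maxima coincide, and every maximum independent set is a maximum comma-free code.

  For the count of classes, the relation \<open><\<close> can be varied without losing the property. Whether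
  \<open>xx\<close> lies in \<open>A\<close> is free for each letter \<open>x\<close>, and it affects the code for all letters but the
  least one: it decides between \<open>xxy\<close> and \<open>yxx\<close> for the letters \<open>y\<close> below \<open>x\<close>. This gives
  \<open>2 ^ (d - 1)\<close> codes. As many again arise by merging the two least letters into one level, with
  \<open>01\<close> and \<open>10\<close> on one side of the cut and \<open>00\<close> and \<open>11\<close> on the other. The words \<open>xyx\<close> and \<open>xxy\<close> in
  a code reveal these choices in a way that does not depend on the names of the letters
  (lemma \<open>profiles_level_code_inj\<close>), so the \<open>2 ^ d\<close> codes are pairwise inequivalent.
\<close>

section \<open>Transversals of the rotation classes\<close>

fun rotations :: "word3 \<Rightarrow> word3 set" where
  "rotations (x, y, z) = {(x, y, z), (y, z, x), (z, x, y)}"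

lemma comma_free_rotated_notin:
  assumes "comma_free d T" "(x, y, z) \<in> T"
  shows "(y, z, x) \<notin> T" "(z, x, y) \<notin> T"
proof -
  have "(y1, y2, y3) \<in> T \<Longrightarrow> (y, z, y1) \<notin> T \<and> (z, y1, y2) \<notin> T" for y1 y2 y3
    using assms by (auto simp: comma_free_def)
  then show "(y, z, x) \<notin> T" "(z, x, y) \<notin> T"
    using assms(2) by blast+
qed

lemma rotations_comma_free_unique:
  assumes "comma_free d T" "v \<in> T" "w \<in> T" "u \<in> rotations v" "u \<in> rotations w"
  shows "v = w"
proof -
  obtain x y z where v: "v = (x, y, z)" by (cases v)
  have "w \<in> rotations v"
    using assms(4,5) v by (cases w) auto
  then show ?thesis
    using comma_free_rotated_notin[OF assms(1), of x y z] assms(2,3) v by auto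
qed

lemma comma_free_not_constant:
  assumes "comma_free d T"
  shows "(x, x, x) \<notin> T"
  using comma_free_rotated_notin(1)[OF assms, of x x x] by blast

lemma finite_words3: "finite (words3 d)"
  by (simp add: words3_def)

text \<open>Sending each word of the comma-free code to a rotation in the transversal is injective.\<close>

lemma card_comma_free_le_transversal:
  assumes T: "comma_free d T"
    and S: "S \<subseteq> words3 d"
    and meets: "\<And>x y z. (x, y, z) \<in> words3 d \<Longrightarrow> \<not> (x = y \<and> y = z)
      \<Longrightarrow> rotations (x, y, z) \<inter> S \<noteq> {}"
  shows "card T \<le> card S"
proof -
  have "\<exists>u. u \<in> rotations w \<and> u \<in> S" if "w \<in> T" for w
  proof -
    obtain x y z where w: "w = (x, y, z)" by (cases w)
    have "(x, y, z) \<in> words3 d" "\<not> (x = y \<and> y = z)"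
      using that T comma_free_not_constant[OF T] w by (auto simp: comma_free_def)
    then show ?thesis using meets w by blast
  qed
  then obtain f where f: "\<And>w. w \<in> T \<Longrightarrow> f w \<in> rotations w \<and> f w \<in> S" by metis
  have "inj_on f T"
    by (rule inj_onI) (metis f rotations_comma_free_unique[OF T])
  moreover have "f ` T \<subseteq> S" using f by blast
  moreover have "finite S" using S finite_words3 finite_subset by blast
  ultimately show ?thesis using card_inj_on_le by blast
qed

section \<open>Directed cuts of the graph on pairs\<close>

lemma independent_imp_comma_free:
  assumes "independent_set (deBruijn3 d) S"
  shows "comma_free d S"
proof -
  have sub: "S \<subseteq> words3 d"
    using assms by (simp add: independent_set_def deBruijn3_def)
  have no_arc: "(y, z, w) \<notin> S" if "(x, y, z) \<in> S" for x y z w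
  proof
    assume "(y, z, w) \<in> S"
    then have "((x, y, z), (y, z, w)) \<notin> parcs (deBruijn3 d)"
      using assms that by (simp add: independent_set_def)
    then show False
      using sub that \<open>(y, z, w) \<in> S\<close> by (auto simp: deBruijn3_def)
  qed
  show ?thesis
    unfolding comma_free_def using sub no_arc by auto
qed

definition dicut :: "nat \<Rightarrow> (nat \<Rightarrow> nat \<Rightarrow> bool) \<Rightarrow> word3 set" where
  "dicut d A = {(x, y, z). (x, y, z) \<in> words3 d \<and> A x y \<and> \<not> A y z}"

lemma dicut_independent: "independent_set (deBruijn3 d) (dicut d A)"
  by (auto simp: independent_set_def deBruijn3_def dicut_def)

lemmas dicut_comma_free = dicut_independent[THEN independent_imp_comma_free]

text \<open>The hypothesis says that each closed walk through \<open>xy\<close>, \<open>yz\<close>, \<open>zx\<close> visits both sides of the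
  cut; going around, it must then step out of \<open>A\<close> somewhere.\<close>

lemma card_comma_free_le_dicut:
  assumes "comma_free d T"
    and two_sided: "\<And>x y z. \<not> (x = y \<and> y = z) \<Longrightarrow> \<not> (A x y = A y z \<and> A y z = A z x)"
  shows "card T \<le> card (dicut d A)"
proof (rule card_comma_free_le_transversal[OF assms(1)])
  show "dicut d A \<subseteq> words3 d" by (auto simp: dicut_def)
next
  fix x y z assume "(x, y, z) \<in> words3 d" "\<not> (x = y \<and> y = z)"
  then show "rotations (x, y, z) \<inter> dicut d A \<noteq> {}"
    using two_sided[of x y z] by (auto simp: dicut_def words3_def)
qed

lemma LMIS_imp_max_comma_free:
  assumes "LMIS d S"
  shows "max_comma_free d S"
proof -
  have "card T \<le> card S" if "comma_free d T" for T
  proof -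
    have "card T \<le> card (dicut d (<))"
      using that by (rule card_comma_free_le_dicut) auto
    also have "\<dots> \<le> card S"
      using assms dicut_independent by (simp add: LMIS_def)
    finally show ?thesis .
  qed
  moreover have "comma_free d S"
    using assms by (simp add: LMIS_def independent_imp_comma_free)
  ultimately show ?thesis by (simp add: max_comma_free_def)
qed

section \<open>A family of codes indexed by subsets of the alphabet\<close>

text \<open>The set \<open>E\<close> encodes the choices as follows. Membership of \<open>0\<close> says that \<open>0\<close> and \<open>1\<close> are ordered
  strictly rather than merged. Membership of \<open>k \<ge> 1\<close> decides on which side of the cut \<open>kk\<close> lies;
  the letter \<open>0\<close> copies the choice of \<open>1\<close>, as it must when the two are merged, and then \<open>01\<close> and
  \<open>10\<close> lie on the other side.\<close>

definition level_rel :: "nat set \<Rightarrow> nat \<Rightarrow> nat \<Rightarrow> bool" where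
  "level_rel E x y \<longleftrightarrow>
    (if x = y then max x 1 \<in> E
     else if x \<le> 1 \<and> y \<le> 1 \<and> 0 \<notin> E then 1 \<notin> E
     else x < y)"

abbreviation level_code :: "nat \<Rightarrow> nat set \<Rightarrow> word3 set" where
  "level_code d E \<equiv> dicut d (level_rel E)"

lemma level_rel_upper:
  assumes "a < b" "1 < b"
  shows "level_rel E a b" "\<not> level_rel E b a"
  using assms by (simp_all add: level_rel_def)

lemma level_rel_loop:
  assumes "a \<noteq> b"
  shows "\<not> (level_rel E a a = level_rel E a b \<and> level_rel E a b = level_rel E b a)"
proof (cases "a \<le> 1 \<and> b \<le> 1 \<and> 0 \<notin> E")
  case True
  then have "max a 1 = 1" by simp
  then show ?thesis using True assms by (simp add: level_rel_def)
next
  case False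
  then show ?thesis using assms by (auto simp: level_rel_def)
qed

text \<open>Among three distinct letters the greatest one, \<open>m\<close>, is at least \<open>2\<close>. The walk enters \<open>m\<close> by
  a pair in the relation and leaves it by a pair outside.\<close>

lemma level_rel_two_sided:
  assumes "\<not> (x = y \<and> y = z)"
  shows "\<not> (level_rel E x y = level_rel E y z \<and> level_rel E y z = level_rel E z x)"
proof -
  consider "x = y" "y \<noteq> z" | "y = z" "z \<noteq> x" | "z = x" "x \<noteq> y"
    | "z < x" "y < x" "1 < x" | "x < y" "z < y" "1 < y" | "y < z" "x < z" "1 < z"
    using assms by linarith
  then show ?thesis
  proof cases
    case 1 then show ?thesis using level_rel_loop[of y z E] by metis
  next
    case 2 then show ?thesis using level_rel_loop[of z x E] by metis
  next
    case 3 then show ?thesis using level_rel_loop[of x y E] by metis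
  next
    case 4 then show ?thesis using level_rel_upper[of z x E] level_rel_upper[of y x E] by metis
  next
    case 5 then show ?thesis using level_rel_upper[of x y E] level_rel_upper[of z y E] by metis
  next
    case 6 then show ?thesis using level_rel_upper[of y z E] level_rel_upper[of x z E] by metis
  qed
qed

lemma max_comma_free_level_code: "max_comma_free d (level_code d E)"
  unfolding max_comma_free_def
proof (intro conjI allI impI)
  show "comma_free d (level_code d E)" by (rule dicut_comma_free)
  show "card T \<le> card (level_code d E)" if "comma_free d T" for T
    using that level_rel_two_sided by (rule card_comma_free_le_dicut)
qed

section \<open>An invariant that separates the codes\<close>

text \<open>For \<open>S = level_code d E\<close> and a letter \<open>x\<close>, the first component counts the letters on higher
  levels, which locates the level of \<open>x\<close>. The second one tells on which side of the cut \<open>xx\<close> lies,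
  except when \<open>x = 0\<close> is alone on the lowest level, where it is false. Only the set of all pairs is
  kept, so that renaming the letters does not change it.\<close>

definition profiles :: "word3 set \<Rightarrow> (nat \<times> bool) set" where
  "profiles S = (\<lambda>x. (card {y. (x, y, x) \<in> S}, \<exists>y. (x, x, y) \<in> S)) ` UNIV"

lemma profiles_act_word:
  assumes "bij \<sigma>"
  shows "profiles (act_word \<sigma> ` S) = profiles S"
proof -
  have inj: "inj \<sigma>" and surj: "range \<sigma> = UNIV"
    using assms by (auto simp: bij_def)
  have mem: "(\<sigma> x, \<sigma> y, \<sigma> z) \<in> act_word \<sigma> ` S \<longleftrightarrow> (x, y, z) \<in> S" for x y z
    using inj by (force simp: act_word_def inj_eq)
  have "card {y. (\<sigma> x, y, \<sigma> x) \<in> act_word \<sigma> ` S} = card {y. (x, y, x) \<in> S}" for x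
  proof -
    have "{y. (\<sigma> x, y, \<sigma> x) \<in> act_word \<sigma> ` S} = \<sigma> ` {y. (x, y, x) \<in> S}"
      using mem surj by (auto simp: image_iff) (metis surjD)
    then show ?thesis
      using inj by (simp add: card_image inj_on_subset)
  qed
  moreover have "(\<exists>y. (\<sigma> x, \<sigma> x, y) \<in> act_word \<sigma> ` S) \<longleftrightarrow> (\<exists>y. (x, x, y) \<in> S)" for x
    using mem surj by (metis surjD)
  \<comment> \<open>The letters are enumerated as \<open>\<sigma> x\<close> instead of \<open>x\<close>.\<close>
  moreover have "profiles (act_word \<sigma> ` S) =
      (\<lambda>x. (card {y. (\<sigma> x, y, \<sigma> x) \<in> act_word \<sigma> ` S}, \<exists>y. (\<sigma> x, \<sigma> x, y) \<in> act_word \<sigma> ` S)) ` UNIV"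
    unfolding profiles_def by (subst surj[symmetric]) (simp only: image_image)
  ultimately show ?thesis by (simp add: profiles_def)
qed

lemma level_code_xyx:
  "card {y. (x, y, x) \<in> level_code d E} = d - 1 - (if 0 \<in> E then x else max x 1)"
proof -
  define r where "r = (if 0 \<in> E then x else max x 1)"
  have rel: "level_rel E x y \<and> \<not> level_rel E y x \<longleftrightarrow> r < y" for y
    unfolding r_def by (cases "0 \<in> E") (auto simp: level_rel_def)
  have "x \<le> r" by (simp add: r_def)
  have "(x, y, x) \<in> level_code d E \<longleftrightarrow> r < y \<and> y < d" for y
  proof -
    have "(x, y, x) \<in> level_code d E \<longleftrightarrow>
        (level_rel E x y \<and> \<not> level_rel E y x) \<and> x < d \<and> y < d"
      by (auto simp: dicut_def words3_def)
    then show ?thesis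
      unfolding rel using \<open>x \<le> r\<close> by linarith
  qed
  then have "{y. (x, y, x) \<in> level_code d E} = {r<..<d}"
    by (simp only: set_eq_iff mem_Collect_eq greaterThanLessThan_iff simp_thms)
  then show ?thesis by (simp add: r_def)
qed

text \<open>If \<open>xx\<close> lies in the relation and \<open>x > 0\<close>, then \<open>x0\<close> lies outside and \<open>y = 0\<close> serves. For \<open>x = 0\<close> only \<open>y = 1\<close> can serve, and only when it is merged with \<open>0\<close>.\<close>

lemma level_code_xxy:
  assumes "d \<ge> 2"
  shows "(\<exists>y. (x, x, y) \<in> level_code d E) \<longleftrightarrow>
    x < d \<and> max x 1 \<in> E \<and> (x = 0 \<longrightarrow> 0 \<notin> E)"
proof -
  have "\<not> level_rel E x (if x = 0 then 1 else 0)" if "max x 1 \<in> E" "x = 0 \<longrightarrow> 0 \<notin> E"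
    using that by (cases "x = 0"; cases "x = 1") (simp_all add: level_rel_def)
  moreover have "level_rel E x y" if "max x 1 \<in> E" "x = 0" "0 \<in> E" for y
    using that by (cases "y = 0") (simp_all add: level_rel_def)
  moreover have "(if x = 0 then 1 else 0) < d" using assms by simp
  moreover have "level_rel E x x \<longleftrightarrow> max x 1 \<in> E" by (simp add: level_rel_def)
  moreover have "(x, x, y) \<in> level_code d E \<longleftrightarrow>
      x < d \<and> y < d \<and> level_rel E x x \<and> \<not> level_rel E x y" for y
    by (auto simp: dicut_def words3_def)
  ultimately show ?thesis by metis
qed

lemma profiles_level_code_zero:
  assumes "d \<ge> 2"
  shows "0 \<in> E \<longleftrightarrow> d - 1 \<in> fst ` profiles (level_code d E)"
proof -
  have "d - 1 \<in> fst ` profiles (level_code d E) \<longleftrightarrow>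
      (\<exists>x. d - 1 = d - 1 - (if 0 \<in> E then x else max x 1))"
    by (auto simp: profiles_def image_image level_code_xyx image_iff)
  also have "\<dots> \<longleftrightarrow> 0 \<in> E"
  proof
    assume "0 \<in> E"
    then show "\<exists>x. d - 1 = d - 1 - (if 0 \<in> E then x else max x 1)"
      by (intro exI[of _ 0]) simp
  qed (use assms in \<open>auto split: if_splits\<close>)
  finally show ?thesis by simp
qed

lemma profiles_level_code_pos:
  assumes "d \<ge> 2" "1 \<le> k" "k < d"
  shows "k \<in> E \<longleftrightarrow> (d - 1 - k, True) \<in> profiles (level_code d E)"
proof
  assume "k \<in> E"
  then show "(d - 1 - k, True) \<in> profiles (level_code d E)"
    unfolding profiles_def level_code_xyx level_code_xxy[OF assms(1)]
    using assms by (intro image_eqI[of _ _ k]) (auto simp: max_def)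
next
  assume "(d - 1 - k, True) \<in> profiles (level_code d E)"
  then obtain x where "d - 1 - k = d - 1 - (if 0 \<in> E then x else max x 1)"
    and x: "x < d" "max x 1 \<in> E" "x = 0 \<longrightarrow> 0 \<notin> E"
    unfolding profiles_def level_code_xyx level_code_xxy[OF assms(1)] by auto
  then have "k = max x 1"
    using assms by (auto simp: max_def split: if_splits)
  then show "k \<in> E" using x by simp
qed

lemma profiles_level_code_inj:
  assumes "d \<ge> 2" "E \<subseteq> {..<d}" "F \<subseteq> {..<d}"
    and eq: "profiles (level_code d E) = profiles (level_code d F)"
  shows "E = F"
proof -
  have "k \<in> E \<longleftrightarrow> k \<in> F" if "k < d" for k
  proof (cases "k = 0")
    case True
    then show ?thesis
      using profiles_level_code_zero[OF assms(1)] eq by simp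
  next
    case False
    then show ?thesis
      using profiles_level_code_pos[OF assms(1) _ that] eq by simp
  qed
  then show ?thesis using assms(2,3) by auto
qed

section \<open>Counting equivalence classes\<close>

lemma card_le_num_classes:
  assumes "finite C" "f ` I \<subseteq> C"
    and inequivalent: "\<And>i j \<sigma>. i \<in> I \<Longrightarrow> j \<in> I \<Longrightarrow> \<sigma> permutes {..<d}
      \<Longrightarrow> f j = act_word \<sigma> ` f i \<Longrightarrow> i = j"
  shows "card I \<le> num_classes d C"
proof -
  let ?cls = "\<lambda>i. code_equiv d C `` {f i}"
  have refl: "(S, S) \<in> code_equiv d C" if "S \<in> C" for S
  proof -
    have "act_word id = id" by (auto simp: act_word_def)
    then show ?thesis
      using that permutes_id[of "{..<d}"] unfolding code_equiv_def
      by (auto intro!: exI[of _ id])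
  qed
  have "inj_on ?cls I"
  proof (rule inj_onI)
    fix i j assume ij: "i \<in> I" "j \<in> I" "?cls i = ?cls j"
    then have "f j \<in> ?cls i" using refl assms(2) by blast
    then show "i = j" using inequivalent ij by (auto simp: code_equiv_def)
  qed
  moreover have "?cls ` I \<subseteq> C // code_equiv d C"
    using assms(2) by (auto simp: quotient_def)
  moreover have "finite (C // code_equiv d C)"
    using assms(1) by (simp add: quotient_def)
  ultimately show ?thesis
    unfolding num_classes_def by (rule card_inj_on_le)
qed

lemma num_classes_ge:
  assumes "d \<ge> 2"
    and C: "C \<subseteq> Pow (words3 d)" "\<And>S. max_comma_free d S \<Longrightarrow> S \<in> C"
  shows "2 ^ d \<le> num_classes d C"
proof -
  have "card (Pow {..<d}) \<le> num_classes d C"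
  proof (rule card_le_num_classes)
    show "finite C" using C(1) finite_words3 by (meson finite_Pow_iff finite_subset)
    show "level_code d ` Pow {..<d} \<subseteq> C" using C(2) max_comma_free_level_code by blast
  next
    fix E F \<sigma>
    assume "E \<in> Pow {..<d}" "F \<in> Pow {..<d}" "\<sigma> permutes {..<d}"
      and "level_code d F = act_word \<sigma> ` level_code d E"
    then show "E = F"
      using profiles_level_code_inj[OF assms(1)] profiles_act_word permutes_bij by (metis PowD)
  qed
  then show ?thesis by (simp add: card_Pow)
qed

theorem theorem5p7:
  fixes d :: nat
  assumes "d \<ge> 1"
  shows "(\<forall>S. LMIS d S \<longrightarrow> max_comma_free d S) \<and>
    (d \<ge> 2 \<longrightarrow>
      2 ^ d \<le> num_classes d {S. max_comma_free d S} \<and>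
      2 ^ d \<le> num_classes d {S. comma_free d S})"
proof (intro conjI impI allI)
  show "max_comma_free d S" if "LMIS d S" for S
    using that by (rule LMIS_imp_max_comma_free)
next
  assume "d \<ge> 2"
  then show "2 ^ d \<le> num_classes d {S. max_comma_free d S}"
    by (rule num_classes_ge) (auto simp: max_comma_free_def comma_free_def)
next
  assume "d \<ge> 2"
  then show "2 ^ d \<le> num_classes d {S. comma_free d S}"
    by (rule num_classes_ge) (auto simp: max_comma_free_def comma_free_def)
qed

end
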